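(* (i) Every irreducible almost lower-triangular transition matrix $L$ on $\mathbb N$ has a unique right eigenvector associated with the eigenvalue $1$ (up to a multiplicative constant), namely the vector whose entries are all equal to one. (ii) The three following cases all arise for irreducible almost lower-triangular transition matrices $L$ on $\mathbb N$: (a) $L$ has no invariant measure; (b) $L$ has a unique invariant measure up to a positive factor; (c) $L$ has several invariant measures which are not equal up to a positive factor.
   Context: $\mathbb N=\{0,1,2,\dots\}$. A transition matrix $L=[L_{i,j}]_{i,j\ge0}$ on $\mathbb N$ (non-negative entries, rows summing to $1$) is almost lower-triangular if $L_{i,j}>0\Rightarrow j\le i+1$. Invariant measures are taken among non-negative measures on $\mathbb N$ with total mass in $(0,+\infty]$; $\pi$ is invariant by $L$ if $\sum_a\pi_aL_{a,b}=\pi_b$ for all $b$. A right eigenvector for the eigenvalue $1$ is a non-zero $R=(R_i)_{i\ge0}$ with $\sum_jL_{i,j}R_j=R_i$ for all $i$. *)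

theory Defs
  imports Complex_Main "HOL-Library.Extended_Nonnegative_Real"
begin

definition transition_matrix :: "(nat \<Rightarrow> nat \<Rightarrow> real) \<Rightarrow> bool" where
  "transition_matrix L \<longleftrightarrow> (\<forall>i j. 0 \<le> L i j) \<and> (\<forall>i. (\<lambda>j. L i j) sums 1)"

definition almost_lower_triangular :: "(nat \<Rightarrow> nat \<Rightarrow> real) \<Rightarrow> bool" where
  "almost_lower_triangular L \<longleftrightarrow> (\<forall>i j. L i j > 0 \<longrightarrow> j \<le> i + 1)"

(* For a transition matrix every series below converges, so that suminf is the true sum. *)
primrec matrix_power :: "(nat \<Rightarrow> nat \<Rightarrow> real) \<Rightarrow> nat \<Rightarrow> nat \<Rightarrow> nat \<Rightarrow> real" where
  "matrix_power L 0 = (\<lambda>i j. if i = j then 1 else 0)"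
| "matrix_power L (Suc n) = (\<lambda>i j. \<Sum>k. L i k * matrix_power L n k j)"

definition irreducible_matrix :: "(nat \<Rightarrow> nat \<Rightarrow> real) \<Rightarrow> bool" where
  "irreducible_matrix L \<longleftrightarrow> (\<forall>i j. \<exists>n. matrix_power L n i j > 0)"

definition irreducible_alt_transition_matrix :: "(nat \<Rightarrow> nat \<Rightarrow> real) \<Rightarrow> bool" where
  "irreducible_alt_transition_matrix L \<longleftrightarrow>
     transition_matrix L \<and> almost_lower_triangular L \<and> irreducible_matrix L"

(* A measure on the naturals is given by its point masses, which are finite; the total mass
   may be infinite.  (With infinite point masses allowed, the measure giving mass infinity to
   every point would be invariant by every irreducible L.) *)
definition invariant_measure :: "(nat \<Rightarrow> nat \<Rightarrow> real) \<Rightarrow> (nat \<Rightarrow> real) \<Rightarrow> bool" where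
  "invariant_measure L \<pi> \<longleftrightarrow>
     (\<forall>a. 0 \<le> \<pi> a) \<and> 0 < (\<Sum>a. ennreal (\<pi> a)) \<and>
     (\<forall>b. (\<lambda>a. \<pi> a * L a b) sums \<pi> b)"

definition right_eigenvector :: "(nat \<Rightarrow> nat \<Rightarrow> real) \<Rightarrow> real \<Rightarrow> (nat \<Rightarrow> real) \<Rightarrow> bool" where
  "right_eigenvector L r R \<longleftrightarrow>
     (\<exists>i. R i \<noteq> 0) \<and> (\<forall>i. (\<lambda>j. L i j * R j) sums (r * R i))"

definition equal_up_to_positive_factor :: "(nat \<Rightarrow> real) \<Rightarrow> (nat \<Rightarrow> real) \<Rightarrow> bool" where
  "equal_up_to_positive_factor \<mu> \<pi> \<longleftrightarrow> (\<exists>c>0. \<forall>a. \<mu> a = c * \<pi> a)"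

end

theory Submission imports Defs begin

text \<open>
  For an almost lower-triangular matrix every row is finitely supported, and irreducibility forces
  every super-diagonal entry to be positive: the only way to leave \<open>{0..i}\<close> is the step from \<open>i\<close> to
  \<open>i + 1\<close>.  Row \<open>i\<close> of the equation \<open>L R = R\<close> therefore determines the entry \<open>R (i + 1)\<close> from the
  previous ones.  As the rows sum to one, constants solve the equation, so there is nothing else.

  Column \<open>b\<close> of the equation \<open>\<pi> L = \<pi>\<close>, in contrast, involves \<open>\<pi> a\<close> for states \<open>a\<close> above \<open>b\<close>, so that
  the entries of \<open>\<pi>\<close> are not determined one after the other and \<open>\<pi>\<close> depends on the behaviour at infinity.
  In all examples the chain moves from \<open>i\<close> up to \<open>i + 1\<close> with probability \<open>p i\<close>, and otherwise drops
  to a prescribed state \<open>d i\<close>.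

  If the chain always drops to \<open>0\<close>, then \<open>\<pi> (b + 1) = \<pi> b * p b\<close> determines \<open>\<pi>\<close> up to a factor, and
  the equation at \<open>0\<close> becomes \<open>\<pi> n \<longlonglongrightarrow> 0\<close>: the chain returns to \<open>0\<close> almost surely.  With
  \<open>p = 1/2\<close> it does, and the invariant measure is unique.  With \<open>p i = 1 - 1/(i + 2)\<^sup>2\<close> the chain
  escapes upwards with probability \<open>1/2\<close>, and there is no invariant measure.

  If the chain drops by two, write \<open>K i\<close> for the odds \<open>p i / (1 - p i)\<close> and \<open>f i = \<pi> i * (1 - p i)\<close> for
  the mass dropping from \<open>i\<close>.  Invariance of \<open>\<pi>\<close> is equivalent to balance of the flows between
  \<open>{0..i}\<close> and its complement, which reads \<open>f (i + 2) + f (i + 1) = K i * f i\<close>.  This second-order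
  recurrence has a two-dimensional space of solutions.  When \<open>K\<close> grows fast, the even and the odd
  terms almost decouple, and there are independent non-negative solutions.
\<close>

section \<open>Rows of almost lower-triangular matrices\<close>

lemma alt_entry_zero:
  assumes "transition_matrix L" "almost_lower_triangular L" "i + 1 < j"
  shows "L i j = 0"
  using assms unfolding transition_matrix_def almost_lower_triangular_def
  by (metis linorder_not_le order_le_less)

lemma alt_row_sums_finite:
  assumes "transition_matrix L" "almost_lower_triangular L"
  shows "(\<lambda>j. L i j * R j) sums (\<Sum>j\<le>i + 1. L i j * R j)"
  by (rule sums_finite) (use alt_entry_zero[OF assms] in auto)

lemma alt_row_sum_eq_one:
  assumes "transition_matrix L" "almost_lower_triangular L"
  shows "(\<Sum>j\<le>i + 1. L i j) = 1"
proof -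
  have "L i sums 1"
    using assms(1) by (simp add: transition_matrix_def)
  moreover have "L i sums (\<Sum>j\<le>i + 1. L i j)"
    using alt_row_sums_finite[OF assms, of i "\<lambda>_. 1"] by simp
  ultimately show ?thesis
    by (rule sums_unique2[symmetric])
qed

lemma matrix_power_Suc_alt:
  assumes "transition_matrix L" "almost_lower_triangular L"
  shows "matrix_power L (Suc n) i j = (\<Sum>k\<le>i + 1. L i k * matrix_power L n k j)"
  using alt_row_sums_finite[OF assms, of i "\<lambda>k. matrix_power L n k j"]
  by (simp add: sums_iff)

lemma matrix_power_nonneg_alt:
  assumes "transition_matrix L" "almost_lower_triangular L"
  shows "0 \<le> matrix_power L n i j"
proof (induction n arbitrary: i)
  case (Suc n)
  then show ?case
    using assms(1) unfolding matrix_power_Suc_alt[OF assms] transition_matrix_def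
    by (intro sum_nonneg mult_nonneg_nonneg) auto
qed simp

text \<open>
  If the entry vanishes, then the states up to \<open>i\<close> cannot be left, contradicting irreducibility.
\<close>

lemma superdiagonal_pos_if_irreducible:
  assumes "irreducible_alt_transition_matrix L"
  shows "0 < L i (i + 1)"
proof (rule ccontr)
  assume "\<not> 0 < L i (i + 1)"
  have L: "transition_matrix L" "almost_lower_triangular L" "irreducible_matrix L"
    using assms by (auto simp: irreducible_alt_transition_matrix_def)
  have closed: "L k j = 0" if "k \<le> i" "i < j" for k j
  proof (cases "k = i \<and> j = i + 1")
    case True
    then show ?thesis
      using \<open>\<not> 0 < L i (i + 1)\<close> L(1) by (simp add: transition_matrix_def order_less_le)
  next
    case False
    then show ?thesis
      using that by (intro alt_entry_zero[OF L(1,2)]) auto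
  qed
  have "matrix_power L n k (i + 1) = 0" if "k \<le> i" for n k
    using that
  proof (induction n arbitrary: k)
    case (Suc n)
    have "L k l * matrix_power L n l (i + 1) = 0" for l
      using closed[of k l] Suc by (cases "l \<le> i") auto
    then have "(\<lambda>l. L k l * matrix_power L n l (i + 1)) = (\<lambda>_. 0)"
      by (rule ext)
    then show ?case
      by simp
  qed simp
  then show False
    using L(3) unfolding irreducible_matrix_def by (metis less_irrefl order_refl)
qed

section \<open>Right eigenvectors for the eigenvalue one\<close>

lemma right_eigenvector_one:
  assumes "transition_matrix L"
  shows "right_eigenvector L 1 (\<lambda>_. 1)"
  using assms by (simp add: right_eigenvector_def transition_matrix_def)

lemma right_eigenvector_constant:
  assumes "irreducible_alt_transition_matrix L" "right_eigenvector L 1 R"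
  shows "R i = R 0"
proof (induction i rule: less_induct)
  case (less i)
  have L: "transition_matrix L" "almost_lower_triangular L"
    using assms(1) by (auto simp: irreducible_alt_transition_matrix_def)
  show ?case
  proof (cases i)
    case (Suc m)
    have "(\<lambda>j. L m j * R j) sums R m"
      using assms(2) by (simp add: right_eigenvector_def)
    with alt_row_sums_finite[OF L] have "R m = (\<Sum>j\<le>m + 1. L m j * R j)"
      by (rule sums_unique2[symmetric])
    moreover have "R m = R 0 * (\<Sum>j\<le>m + 1. L m j)"
      using less[of m] Suc by (simp only: alt_row_sum_eq_one[OF L] mult_1_right)
    ultimately have "0 = (\<Sum>j\<le>m + 1. L m j * R j) - R 0 * (\<Sum>j\<le>m + 1. L m j)"
      by linarith
    also have "\<dots> = (\<Sum>j\<le>m + 1. L m j * (R j - R 0))"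
      unfolding sum_distrib_left right_diff_distrib sum_subtractf by (simp only: mult.commute)
    also have "\<dots> = (\<Sum>j\<le>m. L m j * (R j - R 0)) + L m (m + 1) * (R (m + 1) - R 0)"
      by simp
    also have "(\<Sum>j\<le>m. L m j * (R j - R 0)) = 0"
    proof (rule sum.neutral, rule ballI)
      fix j assume "j \<in> {..m}"
      then show "L m j * (R j - R 0) = 0"
        using less[of j] Suc by simp
    qed
    finally show ?thesis
      using superdiagonal_pos_if_irreducible[OF assms(1), of m] Suc by simp
  qed simp
qed

section \<open>Chains moving one step up or dropping to a prescribed state\<close>

lemma irreducible_if_up_and_down:
  assumes L: "transition_matrix L" "almost_lower_triangular L"
    and up: "\<And>i. 0 < L i (i + 1)"
    and down: "\<And>i. 0 < i \<Longrightarrow> \<exists>k<i. 0 < L i k"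
  shows "irreducible_matrix L"
proof -
  have prepend: "\<exists>n. 0 < matrix_power L n i j" if pos: "0 < L i k" and reach: "\<exists>n. 0 < matrix_power L n k j" for i k j
  proof -
    obtain n where "0 < matrix_power L n k j"
      using reach by blast
    moreover have "k \<le> i + 1"
      using pos L(2) by (simp add: almost_lower_triangular_def)
    ultimately have "0 < (\<Sum>k\<le>i + 1. L i k * matrix_power L n k j)"
      using pos L(1) matrix_power_nonneg_alt[OF L]
      by (intro sum_pos2[of _ k]) (auto simp: transition_matrix_def)
    then show ?thesis
      using matrix_power_Suc_alt[OF L, of n i j] by metis
  qed
  have reach_above: "\<exists>n. 0 < matrix_power L n i j" if "i \<le> j" for i j
    using that
  proof (induction i rule: inc_induct)
    case base
    show ?case
      by (intro exI[of _ 0]) simp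
  next
    case (step i)
    then show ?case
      using prepend[OF up, of i j] by simp
  qed
  have "\<exists>n. 0 < matrix_power L n i j" for i j
  proof (induction i rule: less_induct)
    case (less i)
    show ?case
    proof (cases "i \<le> j")
      case False
      then obtain k where "k < i" "0 < L i k"
        using down[of i] by auto
      then show ?thesis
        using less prepend by blast
    qed (rule reach_above)
  qed
  then show ?thesis
    by (simp add: irreducible_matrix_def)
qed

definition up_or_drop :: "(nat \<Rightarrow> real) \<Rightarrow> (nat \<Rightarrow> nat) \<Rightarrow> nat \<Rightarrow> nat \<Rightarrow> real" where
  "up_or_drop p d i j = (if j = i + 1 then p i else if j = d i then 1 - p i else 0)"

text \<open>
  As drops from positive states are strict, repeated drops lead from every state to \<open>0\<close>.
\<close>

lemma irreducible_up_or_drop: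
  assumes p: "\<And>i. 0 < p i" "\<And>i. p i < 1"
    and d: "d 0 = 0" "\<And>i. 0 < i \<Longrightarrow> d i < i"
  shows "irreducible_alt_transition_matrix (up_or_drop p d)"
proof -
  have d_le: "d i \<le> i" for i
    using d by (cases "i = 0") (auto simp: less_imp_le)
  have "up_or_drop p d i sums 1" for i
  proof -
    have "up_or_drop p d i sums (\<Sum>j\<in>{i + 1, d i}. up_or_drop p d i j)"
      by (rule sums_finite) (auto simp: up_or_drop_def)
    then show ?thesis
      using d_le[of i] by (auto simp: up_or_drop_def)
  qed
  moreover have "0 \<le> up_or_drop p d i j" for i j
    using p[of i] by (simp add: up_or_drop_def)
  ultimately have trans: "transition_matrix (up_or_drop p d)"
    by (simp add: transition_matrix_def)
  have alt: "almost_lower_triangular (up_or_drop p d)"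
    using d_le by (auto simp: almost_lower_triangular_def up_or_drop_def le_SucI split: if_splits)
  have "irreducible_matrix (up_or_drop p d)"
  proof (rule irreducible_if_up_and_down[OF trans alt])
    show "\<exists>k<i. 0 < up_or_drop p d i k" if "0 < i" for i
      using d(2)[OF that] p(2)[of i] by (intro exI[of _ "d i"]) (auto simp: up_or_drop_def)
  qed (use p in \<open>auto simp: up_or_drop_def\<close>)
  with trans alt show ?thesis
    by (simp add: irreducible_alt_transition_matrix_def)
qed

lemma total_mass_pos_iff:
  fixes \<pi> :: "nat \<Rightarrow> real"
  assumes "\<And>a. 0 \<le> \<pi> a"
  shows "0 < (\<Sum>a. ennreal (\<pi> a)) \<longleftrightarrow> (\<exists>a. \<pi> a \<noteq> 0)"
proof
  assume pos: "0 < (\<Sum>a. ennreal (\<pi> a))"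
  show "\<exists>a. \<pi> a \<noteq> 0"
  proof (rule ccontr)
    assume "\<nexists>a. \<pi> a \<noteq> 0"
    with pos show False
      by simp
  qed
next
  assume "\<exists>a. \<pi> a \<noteq> 0"
  then obtain a where "\<pi> a \<noteq> 0" ..
  then have "0 < \<pi> a"
    using assms[of a] by simp
  then have "0 < ennreal (\<pi> a)"
    by simp
  also have "\<dots> \<le> (\<Sum>a. ennreal (\<pi> a))"
    using sum_le_suminf[of "\<lambda>a. ennreal (\<pi> a)" "{a}"] by simp
  finally show "0 < (\<Sum>a. ennreal (\<pi> a))" .
qed

section \<open>Dropping to zero: at most one invariant measure up to a factor\<close>

text \<open>
  Given the equations at positive states, the mass \<open>\<pi> a * (1 - p a)\<close> dropping from \<open>a\<close> equals
  \<open>\<pi> a - \<pi> (a + 1)\<close>, so the equation at \<open>0\<close> telescopes to \<open>\<pi> 0 - lim \<pi> = \<pi> 0\<close>.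
\<close>

lemma invariant_measure_drop_to_zero_iff:
  "invariant_measure (up_or_drop p (\<lambda>_. 0)) \<pi> \<longleftrightarrow>
     (\<forall>a. 0 \<le> \<pi> a) \<and> (\<exists>a. \<pi> a \<noteq> 0) \<and> (\<forall>b. \<pi> (Suc b) = \<pi> b * p b) \<and> \<pi> \<longlonglongrightarrow> 0"
  (is "_ \<longleftrightarrow> ?rhs")
proof -
  let ?L = "up_or_drop p (\<lambda>_. 0)"
  have column_Suc: "(\<lambda>a. \<pi> a * ?L a (Suc b)) sums \<pi> (Suc b) \<longleftrightarrow> \<pi> (Suc b) = \<pi> b * p b" for b
  proof -
    have "(\<lambda>a. \<pi> a * ?L a (Suc b)) sums (\<Sum>a\<in>{b}. \<pi> a * ?L a (Suc b))"
      by (rule sums_finite) (auto simp: up_or_drop_def)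
    then have "(\<lambda>a. \<pi> a * ?L a (Suc b)) sums (\<pi> b * p b)"
      by (simp add: up_or_drop_def)
    then show ?thesis
      by (auto dest: sums_unique2)
  qed
  have column_0: "(\<lambda>a. \<pi> a * ?L a 0) sums \<pi> 0 \<longleftrightarrow> \<pi> \<longlonglongrightarrow> 0" if "\<forall>b. \<pi> (Suc b) = \<pi> b * p b"
  proof -
    have "(\<lambda>a. \<pi> a * ?L a 0) = (\<lambda>a. \<pi> a - \<pi> (Suc a))"
      using that by (auto simp: up_or_drop_def algebra_simps)
    then have "(\<lambda>a. \<pi> a * ?L a 0) sums \<pi> 0 \<longleftrightarrow> (\<lambda>n. \<pi> 0 - \<pi> n) \<longlonglongrightarrow> \<pi> 0"
      by (simp add: sums_def sum_lessThan_telescope')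
    also have "\<dots> \<longleftrightarrow> \<pi> \<longlonglongrightarrow> 0"
      using tendsto_diff[of "\<lambda>_. \<pi> 0" "\<pi> 0" sequentially "\<lambda>n. \<pi> 0 - \<pi> n" "\<pi> 0"]
        tendsto_diff[of "\<lambda>_. \<pi> 0" "\<pi> 0" sequentially \<pi> 0] by auto
    finally show ?thesis .
  qed
  have all_nat_split: "(\<forall>b. Q b) \<longleftrightarrow> Q 0 \<and> (\<forall>b. Q (Suc b))" for Q :: "nat \<Rightarrow> bool"
    by (metis not0_implies_Suc)
  have "(\<forall>b. (\<lambda>a. \<pi> a * ?L a b) sums \<pi> b) \<longleftrightarrow> (\<forall>b. \<pi> (Suc b) = \<pi> b * p b) \<and> \<pi> \<longlonglongrightarrow> 0"
    using column_Suc column_0 by (subst all_nat_split) blast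
  then show ?thesis
    unfolding invariant_measure_def using total_mass_pos_iff[of \<pi>] by blast
qed

text \<open>
  With \<open>p i = 1 - 1/(i + 2)\<^sup>2\<close> the product \<open>p 0 * \<dots> * p (n - 1)\<close> telescopes to \<open>(n + 2) / (2 (n + 1))\<close>,
  which does not tend to \<open>0\<close>.
\<close>

lemma no_invariant_measure_example:
  defines "p \<equiv> \<lambda>i::nat. 1 - 1 / (real i + 2)\<^sup>2"
  shows "irreducible_alt_transition_matrix (up_or_drop p (\<lambda>_. 0))"
    and "\<not> invariant_measure (up_or_drop p (\<lambda>_. 0)) \<pi>"
proof -
  show "irreducible_alt_transition_matrix (up_or_drop p (\<lambda>_. 0))"
  proof (rule irreducible_up_or_drop)
    show "0 < p i" for i
      unfolding p_def by (simp add: power2_eq_square field_simps add_pos_nonneg)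
  qed (auto simp: p_def)
  show "\<not> invariant_measure (up_or_drop p (\<lambda>_. 0)) \<pi>"
  proof
    assume "invariant_measure (up_or_drop p (\<lambda>_. 0)) \<pi>"
    then have ex: "\<exists>a. \<pi> a \<noteq> 0" and rec: "\<And>b. \<pi> (Suc b) = \<pi> b * p b" and lim: "\<pi> \<longlonglongrightarrow> 0"
      by (auto simp: invariant_measure_drop_to_zero_iff)
    have formula: "\<pi> n = \<pi> 0 * ((real n + 2) / (2 * (real n + 1)))" for n
    proof (induction n)
      case (Suc n)
      have "(x + 2) / (2 * (x + 1)) * (1 - 1 / (x + 2)\<^sup>2) = (x + 3) / (2 * (x + 2))"
        if "0 \<le> x" for x :: real
        using that by (simp add: divide_simps power2_eq_square) (simp add: algebra_simps)
      from this[of "real n"] have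
        "(real n + 2) / (2 * (real n + 1)) * p n = (real (Suc n) + 2) / (2 * (real (Suc n) + 1))"
        by (simp add: p_def add.commute)
      then show ?case
        unfolding rec Suc by (simp only: mult.assoc)
    qed simp
    have "\<bar>\<pi> 0\<bar> / 2 \<le> \<bar>\<pi> n\<bar>" for n
    proof -
      have "\<bar>\<pi> 0\<bar> * (1 / 2) \<le> \<bar>\<pi> 0\<bar> * ((real n + 2) / (2 * (real n + 1)))"
        by (intro mult_left_mono) (auto simp: divide_simps)
      then show ?thesis
        by (subst formula[of n]) (simp add: abs_mult)
    qed
    then have "\<bar>\<pi> 0\<bar> / 2 \<le> \<bar>0\<bar>"
      using tendsto_rabs[OF lim] by (intro tendsto_lowerbound) auto
    then have "\<pi> n = 0" for n
      by (subst formula) simp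
    with ex show False
      by simp
  qed
qed

lemma unique_invariant_measure_example:
  defines "L \<equiv> up_or_drop (\<lambda>_. 1 / 2) (\<lambda>_. 0)"
  shows "irreducible_alt_transition_matrix L"
    and "invariant_measure L (\<lambda>i. (1 / 2) ^ i)"
    and "invariant_measure L \<mu> \<Longrightarrow> equal_up_to_positive_factor \<mu> (\<lambda>i. (1 / 2) ^ i)"
proof -
  show "irreducible_alt_transition_matrix L"
    unfolding L_def by (rule irreducible_up_or_drop) auto
  show "invariant_measure L (\<lambda>i. (1 / 2) ^ i)"
    unfolding L_def invariant_measure_drop_to_zero_iff
    by (auto intro: LIMSEQ_realpow_zero)
  assume "invariant_measure L \<mu>"
  then have nonneg: "\<And>a. 0 \<le> \<mu> a" and ex: "\<exists>a. \<mu> a \<noteq> 0" and rec: "\<And>b. \<mu> (Suc b) = \<mu> b * (1 / 2)"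
    by (auto simp: L_def invariant_measure_drop_to_zero_iff)
  have formula: "\<mu> n = \<mu> 0 * (1 / 2) ^ n" for n
    by (induction n) (simp_all add: rec)
  then have "\<mu> 0 \<noteq> 0"
    using ex by (metis mult_zero_left)
  with nonneg[of 0] have "0 < \<mu> 0"
    by simp
  moreover have "\<forall>n. \<mu> n = \<mu> 0 * (1 / 2) ^ n"
    using formula by (rule allI)
  ultimately show "equal_up_to_positive_factor \<mu> (\<lambda>i. (1 / 2) ^ i)"
    unfolding equal_up_to_positive_factor_def by blast
qed

section \<open>Dropping by two: several invariant measures\<close>

text \<open>
  The state \<open>i\<close> has up-probability \<open>K / (K + 1)\<close> for \<open>K = K i\<close>, so \<open>(K i + 1) * f i\<close> is the mass for
  which \<open>f i\<close> drops.  The equation of invariance at \<open>b\<close> is the difference of the balance equations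
  for the cuts above \<open>b\<close> and above \<open>b - 1\<close>.
\<close>

lemma invariant_measure_drop_by_two:
  assumes K: "\<And>i. 0 < K i"
    and f: "\<And>i. 0 \<le> f i" "\<exists>i. f i \<noteq> 0"
    and balance: "\<And>i. f (i + 2) + f (i + 1) = K i * f i"
  shows "invariant_measure (up_or_drop (\<lambda>i. K i / (K i + 1)) (\<lambda>i. i - 2)) (\<lambda>i. (K i + 1) * f i)"
proof -
  let ?L = "up_or_drop (\<lambda>i. K i / (K i + 1)) (\<lambda>i. i - 2)"
  let ?\<pi> = "\<lambda>i. (K i + 1) * f i"
  have K1: "K i + 1 \<noteq> 0" for i
    using K[of i] by simp
  have up: "?\<pi> a * ?L a (Suc a) = K a * f a" for a
    using K1[of a] by (simp add: up_or_drop_def)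
  have drop: "?\<pi> a * ?L a b = f a" if "b = a - 2" for a b
  proof -
    have "b \<noteq> a + 1"
      using that by simp
    then show ?thesis
      using K1[of a] that by (simp add: up_or_drop_def field_simps)
  qed
  have "(\<lambda>a. ?\<pi> a * ?L a b) sums ?\<pi> b" for b
  proof (cases b)
    case 0
    \<comment> \<open>Truncated subtraction sends each of the states \<open>0\<close>, \<open>1\<close> and \<open>2\<close> down to \<open>0\<close>.\<close>
    have "(\<lambda>a. ?\<pi> a * ?L a b) sums (\<Sum>a\<in>{0, 1, 2}. ?\<pi> a * ?L a b)"
      by (rule sums_finite) (auto simp: up_or_drop_def 0)
    also have "(\<Sum>a\<in>{0, 1, 2}. ?\<pi> a * ?L a b) = f 0 + (f 1 + f 2)"
      by (simp add: drop 0)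
    also have "\<dots> = ?\<pi> b"
      using balance[of 0] 0 by (simp add: algebra_simps numeral_2_eq_2)
    finally show ?thesis .
  next
    case (Suc c)
    have "(\<lambda>a. ?\<pi> a * ?L a b) sums (\<Sum>a\<in>{c, c + 3}. ?\<pi> a * ?L a b)"
      by (rule sums_finite) (auto simp: up_or_drop_def Suc)
    also have "(\<Sum>a\<in>{c, c + 3}. ?\<pi> a * ?L a b) = K c * f c + f (c + 3)"
      by (simp add: up drop Suc)
    also have "\<dots> = ?\<pi> b"
      using balance[of c] balance[of "Suc c"] Suc
      by (simp add: algebra_simps numeral_2_eq_2 numeral_3_eq_3)
    finally show ?thesis .
  qed
  moreover have nonneg: "0 \<le> ?\<pi> a" for a
    using K[of a] f(1)[of a] by simp
  moreover have "\<exists>a. ?\<pi> a \<noteq> 0"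
    using f(2) K1 by simp
  ultimately show ?thesis
    unfolding invariant_measure_def using total_mass_pos_iff[of ?\<pi>] by blast
qed

text \<open>
  The second solution is the first one multiplied by \<open>h i = 1 + (-1)^i * u i\<close>.  Substituting \<open>h\<close> in the
  recurrence says that \<open>h i\<close> is the average of \<open>h (i + 2)\<close> and \<open>h (i + 1)\<close> with weights \<open>f (i + 2)\<close> and
  \<open>f (i + 1)\<close>, that is \<open>f (i + 2) / f (i + 1) = (u i + u (i + 1)) / (u (i + 2) - u i)\<close>.  Any
  strictly increasing \<open>u\<close> with values in \<open>(0, 1)\<close> thus yields an example.  The choice
  \<open>u i = 1 - 1 / (3 * 2^i)\<close> makes the ratio \<open>2 * (2^(i + 2) - 1)\<close>.
\<close>

definition decoupled_odds :: "nat \<Rightarrow> real" where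
  "decoupled_odds i = 2 * (2 ^ (i + 1) - 1) * (2 ^ (i + 3) - 1)"

definition drop_flow :: "nat \<Rightarrow> real" where
  "drop_flow i = (\<Prod>j<i. 2 * (2 ^ (j + 1) - 1))"

definition parity_flow :: "nat \<Rightarrow> real" where
  "parity_flow i = drop_flow i * (1 + (-1) ^ i * (1 - 1 / (3 * 2 ^ i)))"

lemma two_power_Suc_gt_one: "1 < (2::real) ^ (i + 1)"
  by (rule one_less_power) auto

lemma decoupled_odds_pos: "0 < decoupled_odds i"
  using two_power_Suc_gt_one[of i] two_power_Suc_gt_one[of "i + 2"]
  by (simp add: decoupled_odds_def numeral_3_eq_3)

lemma drop_flow_pos: "0 < drop_flow i"
  unfolding drop_flow_def by (rule prod_pos) (use two_power_Suc_gt_one in auto)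

lemma drop_flow_Suc: "drop_flow (Suc i) = drop_flow i * (2 * (2 * 2 ^ i - 1))"
  by (simp add: drop_flow_def)

lemma drop_flow_balance: "drop_flow (i + 2) + drop_flow (i + 1) = decoupled_odds i * drop_flow i"
  by (simp add: drop_flow_Suc decoupled_odds_def numeral_2_eq_2 numeral_3_eq_3) (simp add: algebra_simps)

lemma parity_flow_nonneg: "0 \<le> parity_flow i"
proof -
  have "\<bar>(-1) ^ i * (1 - 1 / (3 * 2 ^ i))\<bar> \<le> (1::real)"
    using two_power_Suc_gt_one[of i] by (simp add: abs_mult power_abs abs_le_iff divide_simps)
  then have "0 \<le> 1 + (-1) ^ i * (1 - 1 / (3 * 2 ^ i) :: real)"
    by linarith
  then show ?thesis
    unfolding parity_flow_def using drop_flow_pos[of i] by (intro mult_nonneg_nonneg) auto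
qed

lemma parity_flow_balance:
  "parity_flow (i + 2) + parity_flow (i + 1) = decoupled_odds i * parity_flow i"
proof -
  define x s :: real where "x = 2 ^ i" and "s = (-1) ^ i"
  define D where "D = drop_flow (i + 1)"
  have "0 < x"
    by (simp add: x_def)
  then have key: "2 * (4 * x - 1) * (1 + s * (1 - 1 / (12 * x))) + (1 - s * (1 - 1 / (6 * x)))
      = (8 * x - 1) * (1 + s * (1 - 1 / (3 * x)))"
    by (simp add: divide_simps) (simp add: algebra_simps)
  have "parity_flow (i + 2) = D * (2 * (4 * x - 1) * (1 + s * (1 - 1 / (12 * x))))"
    by (simp add: parity_flow_def D_def drop_flow_Suc x_def s_def numeral_2_eq_2)
  moreover have "parity_flow (i + 1) = D * (1 - s * (1 - 1 / (6 * x)))"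
    by (simp add: parity_flow_def D_def x_def s_def)
  moreover have "decoupled_odds i * parity_flow i = D * ((8 * x - 1) * (1 + s * (1 - 1 / (3 * x))))"
  proof -
    have "decoupled_odds i * drop_flow i = D * (8 * x - 1)"
      by (simp add: decoupled_odds_def D_def drop_flow_Suc x_def numeral_3_eq_3)
    then show ?thesis
      by (simp only: parity_flow_def x_def s_def flip: mult.assoc)
  qed
  ultimately show ?thesis
    by (simp only: key flip: distrib_left)
qed

lemma several_invariant_measures_example:
  defines "L \<equiv> up_or_drop (\<lambda>i. decoupled_odds i / (decoupled_odds i + 1)) (\<lambda>i. i - 2)"
    and "\<pi> \<equiv> \<lambda>i. (decoupled_odds i + 1) * drop_flow i"
    and "\<mu> \<equiv> \<lambda>i. (decoupled_odds i + 1) * parity_flow i"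
  shows "irreducible_alt_transition_matrix L"
    and "invariant_measure L \<pi>" and "invariant_measure L \<mu>"
    and "\<not> equal_up_to_positive_factor \<mu> \<pi>"
proof -
  show "irreducible_alt_transition_matrix L"
    unfolding L_def
  proof (rule irreducible_up_or_drop)
    fix i
    show "0 < decoupled_odds i / (decoupled_odds i + 1)" "decoupled_odds i / (decoupled_odds i + 1) < 1"
      using decoupled_odds_pos[of i] by auto
  qed auto
  have "parity_flow 0 \<noteq> 0"
    by (simp add: parity_flow_def drop_flow_def)
  then show "invariant_measure L \<mu>"
    unfolding L_def \<mu>_def
    by (intro invariant_measure_drop_by_two decoupled_odds_pos parity_flow_nonneg parity_flow_balance) auto
  show "invariant_measure L \<pi>"
    unfolding L_def \<pi>_def
    using drop_flow_pos
    by (intro invariant_measure_drop_by_two decoupled_odds_pos drop_flow_balance)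
      (auto simp: less_imp_le less_imp_neq[symmetric])
  show "\<not> equal_up_to_positive_factor \<mu> \<pi>"
  proof
    assume "equal_up_to_positive_factor \<mu> \<pi>"
    then obtain c where c: "\<And>i. \<mu> i = c * \<pi> i"
      by (auto simp: equal_up_to_positive_factor_def)
    have "decoupled_odds i + 1 \<noteq> 0" for i
      using decoupled_odds_pos[of i] by simp
    then have flow: "parity_flow i = c * drop_flow i" for i
      using c[of i] by (simp add: \<mu>_def \<pi>_def)
    have "c = 5 / 3"
      using flow[of 0] by (simp add: parity_flow_def drop_flow_def)
    moreover have "c = 1 / 6"
      using flow[of 1] by (simp add: parity_flow_def drop_flow_def)
    ultimately show False
      by simp
  qed
qed

section \<open>Right eigenvectors and invariant measures\<close>

theorem theorem2p11:
  shows "(\<forall>L. irreducible_alt_transition_matrix L \<longrightarrow>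
            right_eigenvector L 1 (\<lambda>_. 1) \<and>
            (\<forall>R. right_eigenvector L 1 R \<longrightarrow> (\<exists>c. \<forall>i. R i = c * 1)))
    \<and> (\<exists>L. irreducible_alt_transition_matrix L \<and>
            \<not> (\<exists>\<pi>. invariant_measure L \<pi>))
    \<and> (\<exists>L. irreducible_alt_transition_matrix L \<and>
            (\<exists>\<pi>. invariant_measure L \<pi> \<and>
               (\<forall>\<mu>. invariant_measure L \<mu> \<longrightarrow> equal_up_to_positive_factor \<mu> \<pi>)))
    \<and> (\<exists>L. irreducible_alt_transition_matrix L \<and>
            (\<exists>\<pi> \<mu>. invariant_measure L \<pi> \<and> invariant_measure L \<mu> \<and>
               \<not> equal_up_to_positive_factor \<mu> \<pi>))"
proof (intro conjI allI impI)
  fix L R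
  assume L: "irreducible_alt_transition_matrix L"
  then show "right_eigenvector L 1 (\<lambda>_. 1)"
    by (simp add: irreducible_alt_transition_matrix_def right_eigenvector_one)
  assume "right_eigenvector L 1 R"
  then show "\<exists>c. \<forall>i. R i = c * 1"
    using right_eigenvector_constant[OF L] by (intro exI[of _ "R 0"]) simp
next
  show "\<exists>L. irreducible_alt_transition_matrix L \<and> \<not> (\<exists>\<pi>. invariant_measure L \<pi>)"
    by (intro exI conjI notI, fact no_invariant_measure_example(1))
      (elim exE notE[OF no_invariant_measure_example(2)])
next
  show "\<exists>L. irreducible_alt_transition_matrix L \<and>
      (\<exists>\<pi>. invariant_measure L \<pi> \<and>
        (\<forall>\<mu>. invariant_measure L \<mu> \<longrightarrow> equal_up_to_positive_factor \<mu> \<pi>))"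
    by (intro exI conjI allI impI) (fact unique_invariant_measure_example)+
next
  show "\<exists>L. irreducible_alt_transition_matrix L \<and>
      (\<exists>\<pi> \<mu>. invariant_measure L \<pi> \<and> invariant_measure L \<mu> \<and> \<not> equal_up_to_positive_factor \<mu> \<pi>)"
    by (intro exI conjI) (fact several_invariant_measures_example)+
qed

end
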